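(* Let $X,N,K\ge 1$ be integers, let $f=(f[0],\dots,f[XN-1])$ be an $(X\cdot N)$-element sequence of integers and let $g=(g[0],\dots,g[K-1])$ be a $K$-element filter of integers. For $x\in\{0,\dots,X-1\}$ let $f_x$ be the $N$-element sequence $f_x=f[xN:(x+1)N-1]$, i.e. $f_x[j]=f[xN+j]$ for $0\le j<N$. Let $y=F_{X\cdot N,K}(f,g)$ and $y_x=F_{N,K}(f_x,g)$ be the 1-D convolution output sequences. Then $y$ is the sum of the index-shifted sequences $y_x$: for every integer $n$, $$y[n]=\sum_{x=0}^{X-1} y_x[n-xN].$$
   Context: For integers $L,K\ge1$, an $L$-element sequence $u=(u[0],\dots,u[L-1])$ and a $K$-element kernel $g=(g[0],\dots,g[K-1])$, the 1-D discrete convolution $F_{L,K}(u,g)$ is the sequence indexed by all integers $m$ given by $$F_{L,K}(u,g)[m]=\sum_{k=0}^{K-1} h[m-k]\,g[k],$$ where $h$ is the zero extension of $u$ to all integer indices: $h[n]=u[n]$ for $0\le n<L$, and $h[n]=0$ for $n<0$ or $n\ge L$. *)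

theory Defs
  imports Main
begin

text \<open>A finite sequence of \<open>L\<close> elements is a list of length \<open>L\<close>, so the
  subscripts of \<open>F\<^sub>L\<^sub>,\<^sub>K\<close> are the lengths of the two list arguments.\<close>

definition zero_ext :: "'a::zero list \<Rightarrow> int \<Rightarrow> 'a" where
  "zero_ext u n = (if 0 \<le> n \<and> n < int (length u) then u ! nat n else 0)"

definition conv :: "'a::semiring_0 list \<Rightarrow> 'a list \<Rightarrow> int \<Rightarrow> 'a" where
  "conv u g m = (\<Sum>k<length g. zero_ext u (m - int k) * g ! k)"

text \<open>The block \<open>f[xN : (x+1)N-1]\<close>, both ends included.\<close>

definition block :: "nat \<Rightarrow> 'a list \<Rightarrow> nat \<Rightarrow> 'a list" where
  "block N f x = map (\<lambda>j. f ! (x * N + j)) [0..<N]"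

end

theory Submission
  imports Defs
begin

text \<open>The windows \<open>[x * N, (x + 1) * N)\<close> with \<open>x < X\<close> tile the index
  range of \<open>f\<close>, so the zero extension of \<open>f\<close> is the sum of the shifted
  zero extensions of its blocks (\<open>zero_ext_eq_sum_blocks\<close>). Convolution is linear in
  the zero extension and commutes with index shifts, which carries this decomposition over to the
  outputs.\<close>

text \<open>Membership of \<open>m\<close> in window \<open>x\<close> is encoded by the floor
  quotient, so that at most one block can contribute at a given \<open>m\<close>.\<close>

lemma zero_ext_block:
  assumes len: "length f = X * N" and N: "N \<ge> 1" and x: "x < X"
  shows "zero_ext (block N f x) (m - int x * int N) = (if m div int N = int x then zero_ext f m else 0)"
proof (cases "0 \<le> m - int x * int N \<and> m - int x * int N < int N")
  case True
  define j where "j = nat (m - int x * int N)"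
  have m: "m = int (x * N + j)" and j: "j < N"
    using True by (auto simp: j_def)
  have "Suc x * N \<le> X * N"
    using x by (intro mult_le_mono1) simp
  then have bound: "x * N + j < X * N"
    using j by simp
  have "m div int N = int ((x * N + j) div N)"
    unfolding m by (rule zdiv_int[symmetric])
  then have "m div int N = int x"
    using j by simp
  moreover have "zero_ext f m = f ! (x * N + j)"
    unfolding m zero_ext_def using bound len by (simp del: of_nat_add of_nat_mult)
  moreover have "zero_ext (block N f x) (m - int x * int N) = f ! (x * N + j)"
    using j by (simp add: m zero_ext_def block_def)
  ultimately show ?thesis by simp
next
  case False
  have "m div int N \<noteq> int x"
  proof
    assume "m div int N = int x"
    \<comment> \<open>A remainder modulo \<open>int N\<close> lies in \<open>[0, N)\<close>, so
      \<open>m\<close> would be in the window.\<close>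
    then have "m - int x * int N = m mod int N"
      by (simp add: minus_div_mult_eq_mod flip: \<open>m div int N = int x\<close>)
    with False N show False by simp
  qed
  with False show ?thesis
    by (auto simp: zero_ext_def block_def)
qed

lemma zero_ext_eq_sum_blocks:
  fixes f :: "'a::comm_monoid_add list"
  assumes len: "length f = X * N" and N: "N \<ge> 1"
  shows "zero_ext f m = (\<Sum>x<X. zero_ext (block N f x) (m - int x * int N))"
proof -
  have "(\<Sum>x<X. zero_ext (block N f x) (m - int x * int N))
      = (\<Sum>x<X. if m div int N = int x then zero_ext f m else 0)"
    using zero_ext_block[OF len N] by (intro sum.cong) auto
  also have "\<dots> = zero_ext f m"
  proof (cases "0 \<le> m \<and> m < int (length f)")
    case True
    define q where "q = nat m div N"
    have "m div int N = int q"
      using True by (simp add: q_def zdiv_int)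
    moreover have "q < X"
      unfolding q_def using True N len by (intro less_mult_imp_div_less) linarith
    ultimately show ?thesis
      by simp
  next
    \<comment> \<open>Here the quotient is irrelevant: both branches of the conditional are
      0.\<close>
    case False
    then have "zero_ext f m = 0"
      by (auto simp: zero_ext_def)
    then show ?thesis by (simp cong: if_cong)
  qed
  finally show ?thesis ..
qed

theorem theorem2:
  fixes X N K :: nat and f g :: "int list" and n :: int
  assumes "X \<ge> 1" and "N \<ge> 1" and "K \<ge> 1"
    and "length f = X * N" and "length g = K"
  shows "conv f g n = (\<Sum>x<X. conv (block N f x) g (n - int x * int N))"
proof -
  have "conv f g n
      = (\<Sum>k<length g. \<Sum>x<X. zero_ext (block N f x) (n - int k - int x * int N) * g ! k)"
    unfolding conv_def zero_ext_eq_sum_blocks[OF assms(4,2)] sum_distrib_right ..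
  also have "\<dots> = (\<Sum>x<X. \<Sum>k<length g. zero_ext (block N f x) (n - int k - int x * int N) * g ! k)"
    by (rule sum.swap)
  finally show ?thesis
    \<comment> \<open>The kernel shift by \<open>k\<close> and the block shift by
      \<open>x * N\<close> commute.\<close>
    unfolding conv_def by (simp add: diff_right_commute)
qed

end
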